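(* For every real $\varepsilon$ with $0<\varepsilon<2$ there is an integer $N_\varepsilon$ such that Player 1 has a strategy in the binary sequence game which ensures that any two identical blocks of length $n>N_\varepsilon$ in the resulting infinite sequence lie at distance greater than $(2-\varepsilon)^{n/2}$. That is, whatever Player 2 does, the resulting sequence $\alpha_1\alpha_2\alpha_3\dots$ has the property that for all integers $0\le k<\ell$ and $n>N_\varepsilon$, if $\alpha_{k+i}=\alpha_{\ell+i}$ for all $1\le i\le n$, then $\ell-k>(2-\varepsilon)^{n/2}$.
   Context: The binary sequence game: two players alternately choose digits from $\{0,1\}$, forming an unending sequence $\alpha_1\alpha_2\alpha_3\dots$. Player 1 chooses $\alpha_1,\alpha_3,\alpha_5,\dots$ and Player 2 chooses $\alpha_2,\alpha_4,\alpha_6,\dots$; each choice is made with full knowledge of all previous choices. A strategy for Player 1 is a function assigning to each finite history ending just before a move of Player 1 the digit he plays. It ensures a property if every infinite sequence resulting from play in which Player 1 follows the strategy (with arbitrary moves by Player 2) has that property. A block of length $n$ is a string of $n$ consecutive terms $\alpha_{k+1},\dots,\alpha_{k+n}$ ($k\ge 0$). The distance between the (possibly overlapping) blocks $\alpha_{k+1},\dots,\alpha_{k+n}$ and $\alpha_{\ell+1},\dots,\alpha_{\ell+n}$ with $k<\ell$ is $\ell-k$. *)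

theory Defs
  imports Complex_Main
begin

text \<open>
  The digits 0 and 1 are represented by \<^typ>\<open>bool\<close>.  A play is a function \<alpha> on the natural
  numbers whose terms are \<alpha> 1, \<alpha> 2, \<alpha> 3, and so on; the value \<alpha> 0 is not part of the play
  and is never consulted.
\<close>

type_synonym play = "nat \<Rightarrow> bool"

definition history :: "play \<Rightarrow> nat \<Rightarrow> bool list" where
  "history \<alpha> m = map \<alpha> [1..<m]"

text \<open>
  A strategy for Player 1 sends the history preceding one of his moves to the digit he plays.
  Such histories have even length; the values on lists of odd length are irrelevant.
\<close>

type_synonym strategy = "bool list \<Rightarrow> bool"

definition follows :: "strategy \<Rightarrow> play \<Rightarrow> bool" where
  "follows \<sigma> \<alpha> \<longleftrightarrow> (\<forall>m. odd m \<longrightarrow> \<alpha> m = \<sigma> (history \<alpha> m))"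

definition ensures :: "strategy \<Rightarrow> (play \<Rightarrow> bool) \<Rightarrow> bool" where
  "ensures \<sigma> P \<longleftrightarrow> (\<forall>\<alpha>. follows \<sigma> \<alpha> \<longrightarrow> P \<alpha>)"

text \<open>The block of length n starting after position k consists of the terms k+1, ..., k+n.\<close>

definition block :: "play \<Rightarrow> nat \<Rightarrow> nat \<Rightarrow> bool list" where
  "block \<alpha> k n = map (\<lambda>i. \<alpha> (k + i)) [1..<n + 1]"

lemma block_eq_iff:
  "block \<alpha> k n = block \<alpha> l n \<longleftrightarrow> (\<forall>i. 1 \<le> i \<and> i \<le> n \<longrightarrow> \<alpha> (k + i) = \<alpha> (l + i))"
  by (auto simp: block_def)

end

theory Submission
  imports Defs
begin

text \<open>
  The property is closed, so by compactness it suffices that Player 2 cannot force a violation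
  within any fixed number of rounds.  Against a fixed strategy of Player 2, let \<open>G m\<close> be the set of
  sequences of \<open>m\<close> moves of Player 1 that lead to no violation.  A new violation caused by the
  last round consists of a block of length \<open>n\<close> at the end that repeats an earlier block at a
  distance \<open>\<delta>\<close>; given \<open>n\<close> and \<open>\<delta>\<close>, it determines the last \<open>n div 2\<close> moves of Player 1 from the
  preceding ones.  Hence \<open>card (G (m + 1))\<close> is at least \<open>2 * card (G m)\<close> minus the sum over \<open>n\<close> of
  about \<open>2 * (2 - \<epsilon>) powr (n / 2) * card (G (m + 1 - n div 2))\<close>, and for \<open>\<beta> = 2 - \<epsilon> / 2\<close>
  the inequality \<open>card (G (m + 1)) \<ge> \<beta> * card (G m)\<close> follows by induction on \<open>m\<close>, because the
  resulting geometric series has a small tail.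
\<close>

section \<open>Closed games\<close>

text \<open>\<open>P\<close> is tested only after the last of the \<open>m\<close> rounds; for a
  prefix-closed \<open>P\<close> this amounts to testing it all along.\<close>

fun survives :: "(bool list \<Rightarrow> bool) \<Rightarrow> nat \<Rightarrow> bool list \<Rightarrow> bool" where
  "survives P 0 p = P p"
| "survives P (Suc m) p = (\<exists>d. \<forall>e. survives P m (p @ [d, e]))"

lemma survives_Suc_imp:
  assumes "\<forall>p q. P (p @ q) \<longrightarrow> P p" and "survives P (Suc m) p"
  shows "survives P m p"
  using assms(2)
proof (induction m arbitrary: p)
  case 0
  then show ?case using assms(1) by auto
next
  case (Suc m)
  then obtain d where "\<And>e. survives P (Suc m) (p @ [d, e])"
    using survives.simps(2)[of P "Suc m" p] by blast
  then show ?case using Suc.IH survives.simps(2)[of P m p] by blast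
qed

lemma survives_antimono:
  assumes "\<forall>p q. P (p @ q) \<longrightarrow> P p" and "m \<le> n" and "survives P n p"
  shows "survives P m p"
  using assms(2,3)
proof (induction rule: dec_induct)
  case (step n)
  then show ?case using survives_Suc_imp[of P n p, OF assms(1)] by blast
qed

text \<open>Compactness with two choices: if each digit failed for some reply and some horizon, then
  by antimonotonicity some reply to each would defeat it at the larger of the two horizons.\<close>

lemma survives_all_step:
  assumes "\<forall>p q. P (p @ q) \<longrightarrow> P p" and "\<forall>m. survives P m p"
  shows "\<exists>d. \<forall>e m. survives P m (p @ [d, e])"
proof (rule ccontr)
  assume "\<not> ?thesis"
  then obtain e m where *: "\<And>d. \<not> survives P (m d) (p @ [d, e d])"
    by metis
  let ?M = "max (m True) (m False)"
  obtain d where d: "\<And>e. survives P ?M (p @ [d, e])"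
    using assms(2) survives.simps(2)[of P ?M p] by blast
  have "m d \<le> ?M" by (cases d) auto
  then have "survives P (m d) (p @ [d, e d])"
    using survives_antimono[of P, OF assms(1) _ d] by blast
  with * show False by blast
qed

lemma history_Suc: "0 < m \<Longrightarrow> history \<alpha> (Suc m) = history \<alpha> m @ [\<alpha> m]"
  by (simp add: history_def)

lemma strategy_if_survives_all:
  assumes P: "\<forall>p q. P (p @ q) \<longrightarrow> P p" and surv: "\<forall>m. survives P m []"
  shows "\<exists>\<sigma>. \<forall>\<alpha>. follows \<sigma> \<alpha> \<longrightarrow> (\<forall>r. P (history \<alpha> (2 * r + 1)))"
proof (intro exI allI impI)
  fix \<alpha> r
  \<comment> \<open>The chosen digit keeps every horizon survivable. Where no such digit exists the
    choice is arbitrary, but the induction below shows that such positions are never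
    reached.\<close>
  let ?\<sigma> = "\<lambda>p. SOME d. \<forall>e m. survives P m (p @ [d, e])"
  assume f: "follows ?\<sigma> \<alpha>"
  have "\<forall>m. survives P m (history \<alpha> (2 * r + 1))"
  proof (induction r)
    case 0
    then show ?case using surv by (simp add: history_def)
  next
    case (Suc r)
    let ?p = "history \<alpha> (2 * r + 1)"
    have "\<alpha> (2 * r + 1) = ?\<sigma> ?p"
      using f by (simp add: follows_def)
    moreover have "\<forall>e m. survives P m (?p @ [?\<sigma> ?p, e])"
      by (rule someI_ex[OF survives_all_step[of P, OF P Suc]])
    moreover have "history \<alpha> (2 * Suc r + 1) = ?p @ [\<alpha> (2 * r + 1), \<alpha> (2 * r + 2)]"
      by (simp add: history_Suc)
    ultimately show ?case by (simp only:) simp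
  qed
  then show "P (history \<alpha> (2 * r + 1))"
    by (metis survives.simps(1))
qed

text \<open>
  A strategy \<open>\<tau>\<close> of Player 2 is given here as a function of the previous moves of Player 1 only.
\<close>

fun outcome :: "(bool list \<Rightarrow> bool) \<Rightarrow> bool list \<Rightarrow> bool list" where
  "outcome \<tau> [] = []"
| "outcome \<tau> (d # ds) = d # \<tau> [d] # outcome (\<lambda>ys. \<tau> (d # ys)) ds"

text \<open>Player 2 replies only after at least one move of Player 1, so the value of
  \<open>\<tau>\<close> at the empty list is irrelevant.\<close>

lemma outcome_cong: "(\<And>ys. ys \<noteq> [] \<Longrightarrow> \<tau> ys = \<tau>' ys) \<Longrightarrow> outcome \<tau> xs = outcome \<tau>' xs"
proof (induction xs arbitrary: \<tau> \<tau>')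
  case (Cons d ds)
  have "outcome (\<lambda>ys. \<tau> (d # ys)) ds = outcome (\<lambda>ys. \<tau>' (d # ys)) ds"
    by (rule Cons.IH) (simp add: Cons.prems)
  then show ?case by (simp add: Cons.prems)
qed simp

lemma length_outcome [simp]: "length (outcome \<tau> xs) = 2 * length xs"
  by (induction xs arbitrary: \<tau>) auto

lemma take_outcome: "take (2 * j) (outcome \<tau> xs) = outcome \<tau> (take j xs)"
proof (induction xs arbitrary: \<tau> j)
  case (Cons d ds)
  then show ?case by (cases j) auto
qed simp

lemma nth_outcome: "i < length xs \<Longrightarrow> outcome \<tau> xs ! (2 * i) = xs ! i"
proof (induction xs arbitrary: \<tau> i)
  case (Cons d ds)
  then show ?case by (cases i) auto
qed simp

text \<open>Determinacy of finite games: the winning replies of Player 2 are assembled into one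
  function by recursion on the rounds.\<close>

lemma reply_if_not_survives:
  assumes "\<not> survives P m p"
  shows "\<exists>\<tau>. \<forall>xs. length xs = m \<longrightarrow> \<not> P (p @ outcome \<tau> xs)"
  using assms
proof (induction m arbitrary: p)
  case (Suc m)
  then have "\<forall>d. \<exists>e. \<exists>\<tau>. \<forall>xs. length xs = m \<longrightarrow> \<not> P ((p @ [d, e]) @ outcome \<tau> xs)"
    by (metis survives.simps(2))
  then obtain e \<tau> where
    *: "\<And>d xs. length xs = m \<Longrightarrow> \<not> P ((p @ [d, e d]) @ outcome (\<tau> d) xs)"
    by metis
  \<comment> \<open>After the reply to the first digit, play continues with the function chosen for
    that digit, which sees only the later moves.\<close>
  define \<tau>' where "\<tau>' zs = (if tl zs = [] then e (hd zs) else \<tau> (hd zs) (tl zs))" for zs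
  have "\<not> P (p @ outcome \<tau>' xs)" if "length xs = Suc m" for xs
  proof -
    obtain d ds where xs: "xs = d # ds" "length ds = m"
      using \<open>length xs = Suc m\<close> by (auto simp: length_Suc_conv)
    have "outcome (\<lambda>ys. \<tau>' (d # ys)) ds = outcome (\<tau> d) ds"
      by (rule outcome_cong) (simp add: \<tau>'_def)
    then have "outcome \<tau>' xs = d # e d # outcome (\<tau> d) ds"
      by (simp add: xs) (simp add: \<tau>'_def)
    then show ?thesis using *[OF xs(2), of d] by simp
  qed
  then show ?case by blast
qed simp

section \<open>Counting sequences without close repetitions\<close>

definition spread :: "real \<Rightarrow> nat \<Rightarrow> bool list \<Rightarrow> bool" where
  "spread a N w \<longleftrightarrow> (\<forall>k l n. k < l \<longrightarrow> N < n \<longrightarrow> l + n \<le> length w \<longrightarrow>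
     (\<forall>i<n. w ! (k + i) = w ! (l + i)) \<longrightarrow> a powr (real n / 2) < real (l - k))"

lemma spread_appendD: "spread a N (p @ q) \<Longrightarrow> spread a N p"
  unfolding spread_def by (auto simp: nth_append)

lemma spread_take: "spread a N w \<Longrightarrow> spread a N (take j w)"
  by (metis append_take_drop_id spread_appendD)

definition spread_moves :: "real \<Rightarrow> nat \<Rightarrow> (bool list \<Rightarrow> bool) \<Rightarrow> nat \<Rightarrow> bool list set" where
  "spread_moves a N \<tau> m = {xs. length xs = m \<and> spread a N (outcome \<tau> xs)}"

lemma finite_spread_moves [simp]: "finite (spread_moves a N \<tau> m)"
proof (rule finite_subset)
  show "spread_moves a N \<tau> m \<subseteq> {xs. set xs \<subseteq> UNIV \<and> length xs = m}"
    by (auto simp: spread_moves_def)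
qed (rule finite_lists_length_eq, simp)

lemma take_spread_moves:
  assumes "xs \<in> spread_moves a N \<tau> m" and "j \<le> m"
  shows "take j xs \<in> spread_moves a N \<tau> j"
  using assms spread_take[of a N "outcome \<tau> xs" "2 * j"]
  by (auto simp: spread_moves_def take_outcome)

section \<open>Violations created by the last round\<close>

definition extensions :: "real \<Rightarrow> nat \<Rightarrow> (bool list \<Rightarrow> bool) \<Rightarrow> nat \<Rightarrow> bool list set" where
  "extensions a N \<tau> m = {xs. length xs = Suc m \<and> take m xs \<in> spread_moves a N \<tau> m}"

lemma extensions_eq: "extensions a N \<tau> m = (\<lambda>(xs, d). xs @ [d]) ` (spread_moves a N \<tau> m \<times> UNIV)"
proof (intro equalityI subsetI)
  fix xs assume "xs \<in> extensions a N \<tau> m"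
  then have "xs = take m xs @ [xs ! m]" and "take m xs \<in> spread_moves a N \<tau> m"
    by (auto simp: extensions_def simp flip: take_Suc_conv_app_nth)
  then show "xs \<in> (\<lambda>(xs, d). xs @ [d]) ` (spread_moves a N \<tau> m \<times> UNIV)"
    by (intro image_eqI[where x = "(take m xs, xs ! m)"]) auto
qed (auto simp: extensions_def spread_moves_def)

lemma card_extensions: "card (extensions a N \<tau> m) = 2 * card (spread_moves a N \<tau> m)"
proof -
  have "inj_on (\<lambda>(xs, d). xs @ [d]) (spread_moves a N \<tau> m \<times> UNIV)"
    by (auto simp: inj_on_def)
  then show ?thesis
    unfolding extensions_eq by (simp add: card_image card_cartesian_product)
qed

lemma finite_extensions [simp]: "finite (extensions a N \<tau> m)"
  by (simp add: extensions_eq)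

text \<open>
  The outcome of such a sequence has length \<open>2 * m + 2\<close>, and the later of the two equal blocks
  ends \<open>s\<close> places before its end.
\<close>

definition repeating :: "real \<Rightarrow> nat \<Rightarrow> (bool list \<Rightarrow> bool) \<Rightarrow> nat \<Rightarrow> nat \<Rightarrow> nat \<Rightarrow> nat \<Rightarrow> bool list set"
  where
  "repeating a N \<tau> m n \<delta> s = {xs \<in> extensions a N \<tau> m. \<exists>k.
     k + \<delta> + n + s = 2 * m + 2 \<and>
     (\<forall>i<n. outcome \<tau> xs ! (k + i) = outcome \<tau> xs ! (k + \<delta> + i))}"

lemma finite_repeating [simp]: "finite (repeating a N \<tau> m n \<delta> s)"
  by (simp add: repeating_def)

text \<open>Each entry from \<open>k + \<delta>\<close> on is a copy of the one
  \<open>\<delta>\<close> places earlier, so the first \<open>k + \<delta>\<close> entries determine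
  all of them, even if the blocks overlap.\<close>

lemma nth_eq_if_same_period:
  assumes period: "\<And>i. i < n \<Longrightarrow> v ! (k + i) = v ! (k + \<delta> + i)"
      "\<And>i. i < n \<Longrightarrow> w ! (k + i) = w ! (k + \<delta> + i)"
    and start: "\<And>i. i < k + \<delta> \<Longrightarrow> v ! i = w ! i"
    and "0 < \<delta>" and "i < k + \<delta> + n"
  shows "v ! i = w ! i"
  using assms(5)
proof (induction i rule: less_induct)
  case (less i)
  show ?case
  proof (cases "i < k + \<delta>")
    case False
    define j where "j = i - (k + \<delta>)"
    have "i = k + \<delta> + j" "j < n" "k + j < i"
      using False less.prems \<open>0 < \<delta>\<close> by (auto simp: j_def)
    then show ?thesis using period less.IH[of "k + j"] by auto
  qed (use start in blast)
qed

text \<open>The entries before the later block determine the whole repetition, and they lie within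
  the outcome of the first \<open>Suc m - n div 2\<close> moves. Truncation to these moves is
  therefore injective.\<close>

lemma card_repeating_le:
  assumes "0 < \<delta>" and "s < 2" and "2 \<le> n"
  shows "card (repeating a N \<tau> m n \<delta> s) \<le> card (spread_moves a N \<tau> (Suc m - n div 2))"
proof (rule card_inj_on_le)
  let ?j = "Suc m - n div 2"
  show "inj_on (take ?j) (repeating a N \<tau> m n \<delta> s)"
  proof (rule inj_onI)
    fix xs ys
    assume xs: "xs \<in> repeating a N \<tau> m n \<delta> s" and ys: "ys \<in> repeating a N \<tau> m n \<delta> s"
      and eq: "take ?j xs = take ?j ys"
    obtain k where k: "k + \<delta> + n + s = 2 * m + 2"
      and px: "\<And>i. i < n \<Longrightarrow> outcome \<tau> xs ! (k + i) = outcome \<tau> xs ! (k + \<delta> + i)"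
      using xs by (auto simp: repeating_def)
    have py: "outcome \<tau> ys ! (k + i) = outcome \<tau> ys ! (k + \<delta> + i)" if "i < n" for i
    proof -
      obtain k' where "k' + \<delta> + n + s = 2 * m + 2"
        and "\<And>i. i < n \<Longrightarrow> outcome \<tau> ys ! (k' + i) = outcome \<tau> ys ! (k' + \<delta> + i)"
        using ys by (auto simp: repeating_def)
      \<comment> \<open>Fixing \<open>s\<close> along with \<open>n\<close> and
        \<open>\<delta>\<close> makes the position of the blocks the same for all sequences.\<close>
      moreover from this(1) k have "k' = k" by linarith
      ultimately show ?thesis using that by blast
    qed
    have len: "length xs = Suc m" "length ys = Suc m"
      using xs ys by (auto simp: repeating_def extensions_def)
    have start: "outcome \<tau> xs ! i = outcome \<tau> ys ! i" if "i < k + \<delta>" for i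
    proof -
      have "i < 2 * ?j" using that k by linarith
      moreover have "take (2 * ?j) (outcome \<tau> xs) = take (2 * ?j) (outcome \<tau> ys)"
        by (simp only: take_outcome eq)
      ultimately show ?thesis by (metis nth_take)
    qed
    show "xs = ys"
    proof (rule nth_equalityI)
      fix i assume "i < length xs"
      \<comment> \<open>Since \<open>s < 2\<close>, the later block reaches at least to index
        \<open>2 * m\<close>, the last move of Player 1.\<close>
      then have "2 * i < k + \<delta> + n" using len k \<open>s < 2\<close> by linarith
      then have "outcome \<tau> xs ! (2 * i) = outcome \<tau> ys ! (2 * i)"
        using nth_eq_if_same_period[of n "outcome \<tau> xs" k \<delta> "outcome \<tau> ys", OF px py start \<open>0 < \<delta>\<close>]
        by blast
      then show "xs ! i = ys ! i"
        using \<open>i < length xs\<close> len by (simp add: nth_outcome)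
    qed (simp add: len)
  qed
  show "take ?j ` repeating a N \<tau> m n \<delta> s \<subseteq> spread_moves a N \<tau> ?j"
  proof (rule image_subsetI)
    fix xs assume "xs \<in> repeating a N \<tau> m n \<delta> s"
    then have "take m xs \<in> spread_moves a N \<tau> m"
      by (simp add: repeating_def extensions_def)
    \<comment> \<open>At least the last move is dropped, so the kept part is a prefix of moves
      already known to be good.\<close>
    moreover have "?j \<le> m" using \<open>2 \<le> n\<close> by linarith
    ultimately have "take ?j (take m xs) \<in> spread_moves a N \<tau> ?j"
      by (rule take_spread_moves)
    then show "take ?j xs \<in> spread_moves a N \<tau> ?j"
      using \<open>?j \<le> m\<close> by (simp add: min_absorb1)
  qed
qed simp

lemma extensions_subset:
  "extensions a N \<tau> m \<subseteq> spread_moves a N \<tau> (Suc m) \<union>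
     (\<Union>n\<in>{N<..2 * m + 2}. \<Union>\<delta>\<in>{1..nat \<lfloor>a powr (real n / 2)\<rfloor>}. \<Union>s\<in>{..<2}.
        repeating a N \<tau> m n \<delta> s)"
proof
  fix xs assume xs: "xs \<in> extensions a N \<tau> m"
  let ?w = "outcome \<tau> xs"
  have len: "length xs = Suc m" and tk: "spread a N (take (2 * m) ?w)"
    using xs by (auto simp: extensions_def spread_moves_def take_outcome)
  show "xs \<in> spread_moves a N \<tau> (Suc m) \<union>
     (\<Union>n\<in>{N<..2 * m + 2}. \<Union>\<delta>\<in>{1..nat \<lfloor>a powr (real n / 2)\<rfloor>}. \<Union>s\<in>{..<2}.
        repeating a N \<tau> m n \<delta> s)"
  proof (cases "spread a N ?w")
    case True
    then show ?thesis using len by (simp add: spread_moves_def)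
  next
    case False
    then obtain k l n where kl: "k < l" "N < n" "l + n \<le> 2 * m + 2"
      and eq: "\<forall>i<n. ?w ! (k + i) = ?w ! (l + i)" and le: "real (l - k) \<le> a powr (real n / 2)"
      unfolding spread_def by (auto simp: len not_less)
    \<comment> \<open>A later block ending within the first \<open>m\<close> rounds would already
      have violated the property there.\<close>
    have "2 * m < l + n"
    proof (rule ccontr)
      assume "\<not> 2 * m < l + n"
      then have "a powr (real n / 2) < real (l - k)"
        using tk kl eq unfolding spread_def by (auto simp: len)
      with le show False by linarith
    qed
    define s where "s = 2 * m + 2 - (l + n)"
    have "xs \<in> repeating a N \<tau> m n (l - k) s"
      using xs kl eq unfolding repeating_def s_def by (auto intro!: exI[of _ k])
    moreover have "s \<in> {..<2}"
      using \<open>2 * m < l + n\<close> by (auto simp: s_def)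
    moreover have "l - k \<in> {1..nat \<lfloor>a powr (real n / 2)\<rfloor>}"
      using kl le by (auto simp: le_nat_floor)
    moreover have "n \<in> {N<..2 * m + 2}"
      using kl by auto
    ultimately show ?thesis by blast
  qed
qed

lemma card_spread_moves_recurrence:
  assumes "1 \<le> N"
  shows "2 * real (card (spread_moves a N \<tau> m)) \<le> real (card (spread_moves a N \<tau> (Suc m))) +
    (\<Sum>n\<in>{N<..2 * m + 2}. 2 * a powr (real n / 2) * card (spread_moves a N \<tau> (Suc m - n div 2)))"
proof -
  let ?D = "\<lambda>n. nat \<lfloor>a powr (real n / 2)\<rfloor>"
  let ?g = "\<lambda>n. card (spread_moves a N \<tau> (Suc m - n div 2))"
  let ?U = "\<lambda>n. \<Union>\<delta>\<in>{1..?D n}. \<Union>s\<in>{..<2}. repeating a N \<tau> m n \<delta> s"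
  have U: "card (?U n) \<le> ?D n * (2 * ?g n)" if "n \<in> {N<..2 * m + 2}" for n
  proof -
    have "card (?U n) \<le> (\<Sum>\<delta>\<in>{1..?D n}. card (\<Union>s\<in>{..<2}. repeating a N \<tau> m n \<delta> s))"
      by (rule card_UN_le) simp
    also have "\<dots> \<le> (\<Sum>\<delta>\<in>{1..?D n}. \<Sum>s\<in>{..<2::nat}. card (repeating a N \<tau> m n \<delta> s))"
      by (intro sum_mono card_UN_le) simp
    also have "\<dots> \<le> (\<Sum>\<delta>\<in>{1..?D n}. \<Sum>s\<in>{..<2::nat}. ?g n)"
      using that assms by (intro sum_mono card_repeating_le) auto
    finally show ?thesis by simp
  qed
  have "2 * card (spread_moves a N \<tau> m) = card (extensions a N \<tau> m)"
    by (simp add: card_extensions)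
  also have "\<dots> \<le> card (spread_moves a N \<tau> (Suc m) \<union> (\<Union>n\<in>{N<..2 * m + 2}. ?U n))"
    by (rule card_mono[OF _ extensions_subset]) auto
  also have "\<dots> \<le> card (spread_moves a N \<tau> (Suc m)) + card (\<Union>n\<in>{N<..2 * m + 2}. ?U n)"
    by (rule card_Un_le)
  also have "card (\<Union>n\<in>{N<..2 * m + 2}. ?U n) \<le> (\<Sum>n\<in>{N<..2 * m + 2}. card (?U n))"
    by (rule card_UN_le) simp
  also have "\<dots> \<le> (\<Sum>n\<in>{N<..2 * m + 2}. ?D n * (2 * ?g n))"
    by (rule sum_mono) (rule U)
  finally have "real (2 * card (spread_moves a N \<tau> m)) \<le>
      real (card (spread_moves a N \<tau> (Suc m)) + (\<Sum>n\<in>{N<..2 * m + 2}. ?D n * (2 * ?g n)))"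
    by (simp only: of_nat_le_iff)
  also have "\<dots> = real (card (spread_moves a N \<tau> (Suc m))) +
      (\<Sum>n\<in>{N<..2 * m + 2}. real (?D n) * (2 * real (?g n)))"
    by simp
  also have "(\<Sum>n\<in>{N<..2 * m + 2}. real (?D n) * (2 * real (?g n))) \<le>
      (\<Sum>n\<in>{N<..2 * m + 2}. a powr (real n / 2) * (2 * real (?g n)))"
    by (intro sum_mono mult_right_mono) (auto)
  finally show ?thesis by (simp add: mult_ac)
qed

section \<open>Exponential growth of the number of good sequences\<close>

lemma sum_geometric_tail_le:
  fixes r :: real
  assumes "0 \<le> r" and "r < 1"
  shows "(\<Sum>n\<in>{N<..M}. r ^ n) \<le> r ^ N / (1 - r)"
proof -
  have "(\<Sum>n\<in>{N<..M}. r ^ n) \<le> (\<Sum>n=N..M. r ^ n)"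
    using assms by (intro sum_mono2) auto
  also have "\<dots> \<le> r ^ N / (1 - r)"
    using assms by (auto simp: sum_gp divide_right_mono)
  finally show ?thesis .
qed

text \<open>Rounding \<open>n / 2\<close> down costs at most one half in the exponent and the
  subtraction costs one; two extra factors \<open>\<beta> < 2\<close> cover both.\<close>

lemma power_half_pred_ge:
  fixes \<beta> :: real
  assumes "1 < \<beta>" and "\<beta> < 2" and "2 \<le> n"
  shows "\<beta> powr (real n / 2) \<le> 4 * \<beta> ^ (n div 2 - 1)"
proof -
  have "\<beta> powr (real n / 2) \<le> \<beta> powr real (n div 2 - 1 + 2)"
    using assms by (intro powr_mono) linarith+
  also have "\<dots> = \<beta> ^ (n div 2 - 1) * \<beta>\<^sup>2"
    using assms by (simp only: powr_realpow power_add)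
  also have "\<beta>\<^sup>2 \<le> 2\<^sup>2"
    using assms by (intro power_mono) auto
  finally show ?thesis using assms by (simp add: mult_ac)
qed

text \<open>Writing \<open>a powr (n / 2)\<close> as \<open>r ^ n * \<beta> powr (n / 2)\<close>,
  the second factor is absorbed, up to 4, by the growth already proved for smaller \<open>m\<close>.
  Together with the 2 from the recurrence this gives the constant 8 in \<open>tail\<close>.\<close>

lemma card_spread_moves_growth:
  fixes a \<beta> :: real
  defines "r \<equiv> sqrt (a / \<beta>)"
  assumes a: "0 < a" "a < \<beta>" and \<beta>: "1 < \<beta>" "\<beta> < 2" and "1 \<le> N"
    and tail: "8 * (r ^ N / (1 - r)) \<le> 2 - \<beta>"
  shows "\<beta> * card (spread_moves a N \<tau> m) \<le> card (spread_moves a N \<tau> (Suc m))"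
proof (induction m rule: less_induct)
  case (less m)
  let ?G = "\<lambda>m. real (card (spread_moves a N \<tau> m))"
  \<comment> \<open>The one-step growth of the induction hypothesis is iterated back from
    \<open>m\<close>.\<close>
  have pow: "\<beta> ^ i * ?G (m - i) \<le> ?G m" if "i \<le> m" for i
    using that
  proof (induction i)
    case (Suc i)
    have "\<beta> * ?G (m - Suc i) \<le> ?G (Suc (m - Suc i))"
      using Suc.prems by (intro less.IH) auto
    also have "Suc (m - Suc i) = m - i" using Suc.prems by linarith
    finally have "\<beta> ^ i * (\<beta> * ?G (m - Suc i)) \<le> \<beta> ^ i * ?G (m - i)"
      using \<beta> by (intro mult_left_mono) auto
    then show ?case using Suc by (simp add: mult_ac)
  qed simp
  have r: "0 \<le> r" "r < 1"
    using a \<beta> by (auto simp: r_def)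
  have term_le: "2 * a powr (real n / 2) * ?G (Suc m - n div 2) \<le> 8 * r ^ n * ?G m"
    if "n \<in> {N<..2 * m + 2}" for n
  proof -
    have n: "2 \<le> n" "n div 2 - 1 \<le> m" "Suc m - n div 2 = m - (n div 2 - 1)"
      using that \<open>1 \<le> N\<close> by auto
    have "r ^ n = (a / \<beta>) powr (real n / 2)"
      using a \<beta> by (simp add: r_def powr_powr flip: powr_half_sqrt powr_realpow)
    then have rn: "a powr (real n / 2) = r ^ n * \<beta> powr (real n / 2)"
      using a \<beta> by (simp flip: powr_mult)
    have "\<beta> powr (real n / 2) * ?G (Suc m - n div 2) \<le> 4 * (\<beta> ^ (n div 2 - 1) * ?G (Suc m - n div 2))"
      using mult_right_mono[OF power_half_pred_ge[OF \<beta> n(1)], of "?G (Suc m - n div 2)"] by simp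
    also have "\<dots> \<le> 4 * ?G m"
      using pow[OF n(2)] by (simp add: n(3))
    finally have "2 * r ^ n * (\<beta> powr (real n / 2) * ?G (Suc m - n div 2)) \<le> 2 * r ^ n * (4 * ?G m)"
      using r by (intro mult_left_mono) auto
    then show ?thesis by (simp add: rn mult_ac)
  qed
  have "2 * ?G m \<le> ?G (Suc m) +
      (\<Sum>n\<in>{N<..2 * m + 2}. 2 * a powr (real n / 2) * ?G (Suc m - n div 2))"
    by (rule card_spread_moves_recurrence[OF \<open>1 \<le> N\<close>])
  also have "(\<Sum>n\<in>{N<..2 * m + 2}. 2 * a powr (real n / 2) * ?G (Suc m - n div 2)) \<le>
      (\<Sum>n\<in>{N<..2 * m + 2}. 8 * r ^ n * ?G m)"
    by (rule sum_mono) (rule term_le)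
  also have "\<dots> = 8 * (\<Sum>n\<in>{N<..2 * m + 2}. r ^ n) * ?G m"
    by (simp add: sum_distrib_left sum_distrib_right)
  also have "\<dots> \<le> (2 - \<beta>) * ?G m"
    using sum_geometric_tail_le[OF r, of N "2 * m + 2"] tail
    by (intro mult_right_mono) linarith+
  finally show ?case by (simp add: algebra_simps)
qed

lemma spread_moves_nonempty:
  fixes a \<beta> :: real
  assumes "0 < a" "a < \<beta>" "1 < \<beta>" "\<beta> < 2" "1 \<le> N"
    and "8 * (sqrt (a / \<beta>) ^ N / (1 - sqrt (a / \<beta>))) \<le> 2 - \<beta>"
  shows "spread_moves a N \<tau> m \<noteq> {}"
proof (induction m)
  case 0
  have "[] \<in> spread_moves a N \<tau> 0"
    by (auto simp: spread_moves_def spread_def)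
  then show ?case by blast
next
  case (Suc m)
  then have "0 < \<beta> * card (spread_moves a N \<tau> m)"
    using assms by (simp add: card_gt_0_iff)
  also have "\<dots> \<le> card (spread_moves a N \<tau> (Suc m))"
    by (rule card_spread_moves_growth[OF assms])
  finally show ?case by (metis card.empty less_irrefl of_nat_0)
qed

lemma exists_small_geometric_tail:
  fixes r c :: real
  assumes "0 \<le> r" and "r < 1" and "0 < c"
  shows "\<exists>N\<ge>1. 8 * (r ^ N / (1 - r)) \<le> c"
proof -
  have "(\<lambda>N. 8 * (r ^ N / (1 - r))) \<longlonglongrightarrow> 8 * (0 / (1 - r))"
    using assms by (intro tendsto_intros LIMSEQ_realpow_zero) auto
  then have "\<forall>\<^sub>F N in sequentially. 8 * (r ^ N / (1 - r)) < c"
    using assms by (intro order_tendstoD(2)) auto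
  then have "\<forall>\<^sub>F N in sequentially. 1 \<le> N \<and> 8 * (r ^ N / (1 - r)) < c"
    using eventually_ge_at_top eventually_conj by blast
  then show ?thesis
    using eventually_happens less_imp_le by fastforce
qed

section \<open>From finite lists back to infinite plays\<close>

theorem theorem1p3:
  fixes \<epsilon> :: real
  assumes "0 < \<epsilon>" and "\<epsilon> < 2"
  shows "\<exists>N::int. \<exists>\<sigma>::strategy.
           ensures \<sigma> (\<lambda>\<alpha>. \<forall>(k::nat) (l::nat) (n::nat).
             k < l \<longrightarrow> int n > N \<longrightarrow> block \<alpha> k n = block \<alpha> l n \<longrightarrow>
             real (l - k) > (2 - \<epsilon>) powr (real n / 2))"
proof -
  \<comment> \<open>\<open>\<beta>\<close> is the midpoint of \<open>a\<close> and 2: above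
    \<open>a\<close> for convergence, below 2 to leave room for the losses, and above 1 because
    \<open>\<epsilon> < 2\<close>.\<close>
  define a \<beta> where "a = 2 - \<epsilon>" and "\<beta> = 2 - \<epsilon> / 2"
  have a: "0 < a" "a < \<beta>" "1 < \<beta>" "\<beta> < 2"
    using assms by (auto simp: a_def \<beta>_def)
  obtain N where N: "1 \<le> N" "8 * (sqrt (a / \<beta>) ^ N / (1 - sqrt (a / \<beta>))) \<le> 2 - \<beta>"
    using exists_small_geometric_tail[of "sqrt (a / \<beta>)" "2 - \<beta>"] a by auto
  have "survives (spread a N) m []" for m
  proof (rule ccontr)
    assume "\<not> survives (spread a N) m []"
    then obtain \<tau> where "\<And>xs. length xs = m \<Longrightarrow> \<not> spread a N (outcome \<tau> xs)"
      using reply_if_not_survives[of "spread a N" m "[]"] by auto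
    then have "spread_moves a N \<tau> m = {}"
      by (auto simp: spread_moves_def)
    then show False
      using spread_moves_nonempty[OF a N] by blast
  qed
  then obtain \<sigma> where \<sigma>: "\<And>\<alpha> r. follows \<sigma> \<alpha> \<Longrightarrow> spread a N (history \<alpha> (2 * r + 1))"
    using strategy_if_survives_all[of "spread a N"] spread_appendD by blast
  have "real (l - k) > (2 - \<epsilon>) powr (real n / 2)"
    if "follows \<sigma> \<alpha>" "k < l" "int n > int N" "block \<alpha> k n = block \<alpha> l n" for \<alpha> k l n
  proof -
    \<comment> \<open>This history consists of \<open>l + n\<close> full rounds and so contains both
      blocks; list indices start at 0, play positions at 1.\<close>
    let ?h = "history \<alpha> (2 * (l + n) + 1)"
    have nth: "?h ! i = \<alpha> (Suc i)" if "i < 2 * (l + n)" for i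
      using that by (simp add: history_def del: upt_Suc)
    have "\<forall>i<n. ?h ! (k + i) = ?h ! (l + i)"
    proof (intro allI impI)
      fix i assume "i < n"
      then have "\<alpha> (k + Suc i) = \<alpha> (l + Suc i)"
        using that(4)[unfolded block_eq_iff, rule_format, of "Suc i"] by simp
      then show "?h ! (k + i) = ?h ! (l + i)"
        using \<open>i < n\<close> \<open>k < l\<close> nth[of "k + i"] nth[of "l + i"] by simp
    qed
    moreover have "l + n \<le> length ?h"
      by (simp add: history_def del: upt_Suc)
    ultimately show ?thesis
      using \<sigma>[OF that(1), of "l + n"] that(2,3) unfolding spread_def a_def by auto
  qed
  then show ?thesis unfolding ensures_def by blast
qed

end
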